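(* Let $p$ be an odd prime and $q$ a power of $p$. Define $b_k\in\mathbb{F}_q$ ($1\le k\le q^2-q+1$) by $\sum_{k=1}^{q^2-q+1}b_kz^k=z\bigl(-1-(z-z^q)^{q-1}\bigr)$ in $\mathbb{F}_q[z]$, and define $c_k\in\mathbb{F}_q$ ($1\le k\le q^2+q-1$) by $$\sum_{k=1}^{q^2+q-1}c_kz^k=(1+z^{q-1}-z^q)\sum_{k=1}^{q^2-1}z^k-\Bigl(z^{2(q-1)}+\sum_{j=1}^{q-1}(z-1)^{q-1-j}z^{2j}\bigl(\tfrac14\bigr)^j\Bigr)\Bigl(\sum_{k=1}^{q^2-q+1}b_kz^k\Bigr).$$ Then, with all quantities computed in $\mathbb{F}_q$: (i) $\sum_{a\in\mathbb{F}_q}F_j(1,a)=-c_j+\frac{j}{2^{j-1}}$ for $1\le j\le q-1$; (ii) $\sum_{a\in\mathbb{F}_q}F_q(1,a)=c_1-c_q$; (iii) for $1\le l\le q-2$ and $1\le j\le q-1$, $\sum_{a\in\mathbb{F}_q}F_{lq+j}(1,a)=\sum_{a\in\mathbb{F}_q}F_{(l-1)q+j}(1,a)-\sum_{a\in\mathbb{F}_q}F_{(l-1)q+j+1}(1,a)-c_{lq+j}+\frac{2^q(1-j)+2j}{2^{lq+j}}$; (iv) for $2\le l\le q-2$, $\sum_{a\in\mathbb{F}_q}F_{lq}(1,a)=\sum_{a\in\mathbb{F}_q}F_{(l-1)q}(1,a)-\sum_{a\in\mathbb{F}_q}F_{(l-1)q+1}(1,a)-c_{lq}+\frac{1}{2^{(l-1)q}}$;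 (v) for $0\le j\le q-1$, $\sum_{a\in\mathbb{F}_q}F_{q^2-q+j}(1,a)=\sum_{i=j}^{q-1}c_{q^2+i}+\frac{j}{2^{q^2-q+j-1}}$.
   Context: For an integer $n\ge 1$, the $n$-th reversed Dickson polynomial of the third kind is $F_n(a,x)=\sum_{i=0}^{\lfloor n/2\rfloor}\frac{n-2i}{n-i}\binom{n-i}{i}(-x)^i a^{n-2i}$, where each coefficient $\frac{n-2i}{n-i}\binom{n-i}{i}$ is an integer (read in $\mathbb{F}_q$), and $F_0(a,x)=0$. *)

theory Defs
  imports "HOL-Computational_Algebra.Computational_Algebra"
begin

text \<open>Reversed Dickson polynomial of the third kind, F_n(a,x), with F_0 = 0.
  The integer coefficient (n-2i)/(n-i) * binom(n-i,i) is computed exactly in nat.\<close>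
definition rdickson3 :: "nat \<Rightarrow> 'a::comm_ring_1 \<Rightarrow> 'a \<Rightarrow> 'a" where
  "rdickson3 n a x = (if n = 0 then 0 else
     (\<Sum>i = 0..n div 2. of_nat (((n - 2*i) * ((n - i) choose i)) div (n - i)) * (- x) ^ i * a ^ (n - 2*i)))"

definition bpoly :: "nat \<Rightarrow> 'a::field poly" where
  "bpoly q = [:0, 1:] * (- 1 - ([:0, 1:] - monom 1 q) ^ (q - 1))"

definition cpoly :: "nat \<Rightarrow> 'a::field poly" where
  "cpoly q =
     (1 + monom 1 (q - 1) - monom 1 q) * (\<Sum>k = 1..q^2 - 1. monom 1 k)
     - (monom 1 (2*(q - 1)) + (\<Sum>j = 1..q - 1. ([:-1, 1:]) ^ (q - 1 - j) * monom 1 (2*j) * [:(1/4) ^ j:]))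
       * bpoly q"

definition bcoef :: "nat \<Rightarrow> nat \<Rightarrow> 'a::field" where
  "bcoef q k = coeff (bpoly q) k"

definition ccoef :: "nat \<Rightarrow> nat \<Rightarrow> 'a::field" where
  "ccoef q k = coeff (cpoly q) k"

end

theory Submission
  imports Defs
begin

text \<open>
  Write \<open>v = z^(q - 1)\<close>, \<open>y = z - 1\<close> and let \<open>G\<close> be the generating function of the sums
  \<open>S n\<close> of \<open>F_n(1, a)\<close> over all \<open>a\<close>. Since \<open>F_n(1, a)\<close> has generating function
  \<open>z / (1 - z + a z^2)\<close>, summing over \<open>a\<close> by means of a finite geometric series in \<open>a\<close> and the
  vanishing of power sums yields \<open>G (1 - v y) (1 - v) = - z^(2q - 1)\<close>. On the other hand, the
  polynomial with coefficients \<open>c_k\<close> collapses to \<open>(z - z^(q^2)) (z - 2)^(2q - 2) / (1 - v)\<close>.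
  The coefficients of \<open>(z - 2)^(2q - 2)\<close> are explicit, and modulo \<open>z^(q^2)\<close> the series
  \<open>G (1 - v y) + \<Sum>k. c_k z^k\<close> turns out to have coefficients \<open>n / 2^(n - 1)\<close> for \<open>n < q\<close> and
  \<open>1 / 2^(n - 1)\<close> from there on. Comparing coefficients gives (i)--(iv). For (v) both sides are
  computed: expanding \<open>1 / ((1 - v) (1 - v y))\<close> as a double geometric series gives
  \<open>S (q^2 - q + j) = 1 - 1 / 2^(j - 1)\<close> for \<open>1 \<le> j < q\<close> and \<open>S (q^2 - q) = 0\<close>.
\<close>

section \<open>Finite fields and powers of linear polynomials\<close>

lemma card_finite_field_gt_1: "1 < card (UNIV :: 'a::finite_field set)"
  using card_mono[of UNIV "{0, 1::'a}"] by simp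

text \<open>Translation by 1 permutes the field, so adding 1 to every summand does not change the
  sum of all elements.\<close>

lemma of_nat_card_eq_0: "of_nat (card (UNIV :: 'a::finite_field set)) = (0::'a)"
proof -
  have "(\<Sum>x\<in>(UNIV::'a set). x + 1) = (\<Sum>x\<in>(UNIV::'a set). x)"
    by (rule sum.reindex_bij_witness[of _ "\<lambda>x. x - 1" "\<lambda>x. x + 1"]) auto
  then show ?thesis
    by (simp add: sum.distrib)
qed

lemma two_neq_0_odd_card:
  assumes "odd (card (UNIV :: 'a::finite_field set))"
  shows "(2::'a) \<noteq> 0"
proof
  assume "(2::'a) = 0"
  then have "of_nat (card (UNIV :: 'a set)) = (1::'a)"
    using assms by (auto elim!: oddE)
  then show False
    using of_nat_card_eq_0[where 'a = 'a] by simp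
qed

lemma finite_field_power_card_pred:
  fixes a :: "'a::finite_field"
  assumes "a \<noteq> 0" and q: "q = card (UNIV :: 'a set)"
  shows "a ^ (q - 1) = 1"
proof -
  have "q > 0"
    using q by (simp add: card_gt_0_iff)
  then have "a * a ^ (q - 1) = a * 1"
    using finite_field_power_card_eq_same[of a] q by (simp flip: power_Suc)
  with assms(1) show ?thesis
    by simp
qed

text \<open>Some nonzero \<open>g\<close> has \<open>g ^ i\<close> different from 1, because
  \<open>z^i - 1\<close> has at most \<open>i\<close> roots; replacing \<open>a\<close> by
  \<open>g * a\<close> then multiplies the sum by \<open>g ^ i\<close>. For \<open>i = 0\<close>
  every summand is 1, including \<open>0 ^ 0\<close>, and the sum is \<open>q = 0\<close>.\<close>

lemma sum_powers_finite_field: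
  assumes q: "q = card (UNIV :: 'a::finite_field set)" and "i < q - 1"
  shows "(\<Sum>a\<in>(UNIV :: 'a set). a ^ i) = 0"
proof (cases "i = 0")
  case True
  then show ?thesis
    using of_nat_card_eq_0[where 'a = 'a] by simp
next
  case False
  have "\<exists>g::'a. g \<noteq> 0 \<and> g ^ i \<noteq> 1"
  proof (rule ccontr)
    assume "\<not> ?thesis"
    then have sub: "UNIV - {0::'a} \<subseteq> {x. poly (monom 1 i - 1) x = 0}"
      by (auto simp: poly_monom)
    have ne: "monom 1 i - 1 \<noteq> (0 :: 'a poly)"
      using False by (metis right_minus_eq monom_eq_1_iff)
    have "card (UNIV - {0::'a}) \<le> card {x::'a. poly (monom 1 i - 1) x = 0}"
      using sub by (intro card_mono) simp_all
    also have "\<dots> \<le> degree (monom 1 i - 1 :: 'a poly)"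
      by (rule card_poly_roots_bound[OF ne])
    also have "\<dots> \<le> i"
      by (rule degree_diff_le) (auto simp: degree_monom_eq)
    finally have "card (UNIV - {0::'a}) \<le> i" .
    then show False
      using assms by (simp add: card_Diff_singleton)
  qed
  then obtain g :: 'a where g: "g \<noteq> 0" "g ^ i \<noteq> 1"
    by blast
  have "(\<Sum>a\<in>(UNIV :: 'a set). a ^ i) = (\<Sum>a\<in>(UNIV :: 'a set). (g * a) ^ i)"
    using g(1) by (intro sum.reindex_bij_witness[of _ "\<lambda>a. g * a" "\<lambda>a. a / g"]) auto
  also have "\<dots> = g ^ i * (\<Sum>a\<in>(UNIV :: 'a set). a ^ i)"
    by (simp add: power_mult_distrib sum_distrib_left)
  finally show ?thesis
    using g(2) by (metis mult_cancel_right1)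
qed

lemma half_power_card_pred:
  assumes q: "q = card (UNIV :: 'a::finite_field set)" and "odd q"
  shows "(1 / 2 :: 'a) ^ (q - 1) = 1"
  using finite_field_power_card_pred[OF _ q, of "1 / 2"] two_neq_0_odd_card[where 'a = 'a] assms
  by simp

lemma of_nat_card_pred:
  assumes "q = card (UNIV :: 'a::finite_field set)"
  shows "of_nat (q - 1) = (-1 :: 'a)"
  using card_finite_field_gt_1[where 'a = 'a] of_nat_card_eq_0[where 'a = 'a] assms
  by (simp add: of_nat_diff)

text \<open>Both sides have degree at most \<open>q\<close>, the same coefficient at
  \<open>q\<close>, and equal values at all \<open>q\<close> field elements because
  \<open>x ^ q = x\<close>.\<close>

lemma linear_power_card:
  fixes c :: "'a::finite_field"
  assumes "q = card (UNIV :: 'a set)"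
  shows "[:-c, 1:] ^ q = monom 1 q - [:c:]"
proof (rule poly_eqI_degree_lead_coeff[where A = UNIV and n = q])
  show "card (UNIV :: 'a set) \<ge> q"
    using assms by simp
  show "degree (monom 1 q - [:c:]) \<le> q"
    by (rule degree_diff_le) (auto simp: degree_monom_eq)
  show "degree ([:-c, 1:] ^ q) \<le> q"
    by (simp add: degree_linear_power)
  have "q > 0"
    using assms by (simp add: card_gt_0_iff)
  then show "coeff ([:-c, 1:] ^ q) q = coeff (monom 1 q - [:c:]) q"
    by (simp add: coeff_linear_power coeff_pCons split: nat.splits)
  show "poly ([:-c, 1:] ^ q) x = poly (monom 1 q - [:c:]) x" for x
    using finite_field_power_card_eq_same[of "x - c"] finite_field_power_card_eq_same[of x] assms
    by (simp add: poly_power poly_monom)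
qed

lemma linear_power_card_pred:
  fixes c :: "'a::finite_field"
  assumes q: "q = card (UNIV :: 'a set)"
  shows "[:-c, 1:] ^ (q - 1) = (\<Sum>i<q. monom (c ^ (q - 1 - i)) i)"
proof -
  have "q > 0"
    using q by (simp add: card_gt_0_iff)
  have c: "c ^ q = c"
    using finite_field_power_card_eq_same[of c] q by simp
  \<comment> \<open>Writing \<open>c\<close> as \<open>c ^ q\<close> gives a difference of
    \<open>q\<close>-th powers, from which \<open>z - c\<close> splits off and cancels.\<close>
  have "[:-c, 1:] * [:-c, 1:] ^ (q - 1) = monom 1 q - [:c ^ q:]"
    using linear_power_card[OF q, of c] \<open>q > 0\<close> c by (simp flip: power_Suc)
  also have "\<dots> = [:0, 1:] ^ q - [:c:] ^ q"
    by (simp add: monom_altdef poly_const_pow)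
  also have "\<dots> = ([:0, 1:] - [:c:]) * (\<Sum>i<q. [:c:] ^ (q - Suc i) * [:0, 1:] ^ i)"
    by (simp add: power_diff_sumr2)
  also have "\<dots> = [:-c, 1:] * (\<Sum>i<q. monom (c ^ (q - 1 - i)) i)"
    by (simp add: monom_altdef poly_const_pow)
  finally show ?thesis
    by (simp only: mult_cancel_left pCons_eq_0_iff one_neq_zero simp_thms)
qed

lemma coeff_linear_power_card_pred:
  fixes c :: "'a::finite_field"
  assumes q: "q = card (UNIV :: 'a set)"
  shows "coeff ([:-c, 1:] ^ (q - 1)) i = (if i < q then c ^ (q - 1 - i) else 0)"
  unfolding linear_power_card_pred[OF q] by (simp add: coeff_sum)

lemma coeff_linear_power_two:
  assumes q: "q = card (UNIV :: 'a::finite_field set)" and "odd q"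
  shows "coeff ([:-2, 1:] ^ (q - 1)) i = (if i < q then (1 / 2 :: 'a) ^ i else 0)"
proof -
  have two: "(2::'a) \<noteq> 0"
    using two_neq_0_odd_card[where 'a = 'a] assms by simp
  have "2 ^ (q - 1) = (1::'a)"
    by (rule finite_field_power_card_pred[OF two q])
  then have "2 ^ (q - 1 - i) = (1 / 2 :: 'a) ^ i" if "i < q"
    using two that by (simp add: power_diff power_one_over)
  then show ?thesis
    unfolding coeff_linear_power_card_pred[OF q] by (simp only: cong: if_cong)
qed

text \<open>Every nonzero term of the convolution equals \<open>(1/2) ^ n\<close>, so only their
  number matters. Truncated subtraction makes the lower end 0 for small \<open>n\<close>; for
  \<open>n > 2(q - 1)\<close> the interval is empty.\<close>

lemma coeff_linear_power_square:
  assumes q: "q = card (UNIV :: 'a::finite_field set)" and "odd q"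
  shows "coeff (([:-2, 1:] ^ (q - 1)) ^ 2) n
    = of_nat (card {n - (q - 1)..min n (q - 1)}) * (1 / 2 :: 'a) ^ n"
proof -
  define N where "N = q - 1"
  have coeff: "coeff ([:-2, 1:] ^ N) i = (if i \<le> N then (1 / 2 :: 'a) ^ i else 0)" for i
    using coeff_linear_power_two[OF q \<open>odd q\<close>, of i] \<open>odd q\<close>
    by (auto simp: N_def elim: oddE)
  have "coeff (([:-2, 1:] ^ N) ^ 2) n
      = (\<Sum>i\<le>n. if i \<in> {n - N..min n N} then (1 / 2 :: 'a) ^ n else 0)"
    unfolding power2_eq_square coeff_mult
    by (rule sum.cong)
       (auto simp: coeff simp flip: power_add)
  also have "\<dots> = (\<Sum>i\<in>{..n} \<inter> {n - N..min n N}. (1 / 2 :: 'a) ^ n)"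
    by (subst sum.inter_restrict) auto
  also have "{..n} \<inter> {n - N..min n N} = {n - N..min n N}"
    by auto
  finally show ?thesis
    by (simp add: N_def)
qed

lemma coeff_linear_power_square_le:
  assumes "q = card (UNIV :: 'a::finite_field set)" "odd q" "n \<le> q - 1"
  shows "coeff (([:-2, 1:] ^ (q - 1)) ^ 2) n = of_nat (Suc n) * (1 / 2 :: 'a) ^ n"
  unfolding coeff_linear_power_square[OF assms(1,2)] using assms(3) by (simp add: min_def)

text \<open>In the upper half there are \<open>q - i\<close> terms, which is \<open>-i\<close> in
  the field, and the shift by \<open>q - 1\<close> leaves the power of \<open>1/2\<close>
  unchanged.\<close>

lemma coeff_linear_power_square_ge:
  assumes q: "q = card (UNIV :: 'a::finite_field set)" and "odd q"
  shows "coeff (([:-2, 1:] ^ (q - 1)) ^ 2) (q - 1 + i)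
    = (if i \<le> q - 1 then - (of_nat i * (1 / 2 :: 'a) ^ i) else 0)"
proof (cases "i \<le> q - 1")
  case True
  have "q > 0"
    using \<open>odd q\<close> by (auto elim: oddE)
  have "card {q - 1 + i - (q - 1)..min (q - 1 + i) (q - 1)} = q - i"
    using True \<open>q > 0\<close> by simp
  moreover have "of_nat (q - i) = - (of_nat i :: 'a)"
    using True of_nat_card_eq_0[where 'a = 'a] q by (simp add: of_nat_diff)
  moreover have "(1 / 2 :: 'a) ^ (q - 1 + i) = (1 / 2) ^ i"
    by (simp only: power_add half_power_card_pred[OF assms] mult_1_left)
  ultimately show ?thesis
    unfolding coeff_linear_power_square[OF assms] using True by simp
next
  case False
  then show ?thesis
    unfolding coeff_linear_power_square[OF assms] by simp
qed

section \<open>The generating function of the sums\<close>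

text \<open>Pascal's rule along the diagonals of the triangle. Summing up to \<open>n\<close>
  instead of \<open>n div 2\<close> only adds vanishing binomials.\<close>

lemma sum_diagonal_binomial_rec:
  fixes b :: "'a::comm_ring_1"
  defines "t \<equiv> (\<lambda>n. \<Sum>i\<le>n. of_nat ((n - i) choose i) * b ^ i)"
  shows "t (Suc (Suc n)) = t (Suc n) + b * t n"
proof -
  have "t (Suc (Suc n)) = 1 + (\<Sum>i\<le>Suc n. of_nat ((Suc n - i) choose Suc i) * b ^ Suc i)"
    unfolding t_def by (subst sum.atMost_Suc_shift) simp
  also have "\<dots> = 1 + (\<Sum>i\<le>n. of_nat ((Suc (n - i)) choose Suc i) * b ^ Suc i)"
    by (simp add: Suc_diff_le)
  also have "\<dots> = (1 + (\<Sum>i\<le>n. of_nat ((n - i) choose Suc i) * b ^ Suc i)) + b * t n"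
    by (simp add: t_def algebra_simps sum.distrib sum_distrib_left)
  also have "1 + (\<Sum>i\<le>n. of_nat ((n - i) choose Suc i) * b ^ Suc i) = t (Suc n)"
    unfolding t_def by (subst sum.atMost_Suc_shift) simp
  finally show ?thesis .
qed

text \<open>The absorption identity for binomials shows that the division in the coefficient is
  exact and leaves a single binomial.\<close>

lemma rdickson3_Suc:
  fixes a :: "'a::comm_ring_1"
  shows "rdickson3 (Suc n) 1 a = (\<Sum>i\<le>n. of_nat ((n - i) choose i) * (- a) ^ i)"
proof -
  have "rdickson3 (Suc n) 1 a
      = (\<Sum>i = 0..Suc n div 2. of_nat ((n - i) choose i) * (- a) ^ i)"
    unfolding rdickson3_def
  proof (simp del: power_Suc, rule sum.cong[OF refl])
    fix i
    assume "i \<in> {0..Suc n div 2}"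
    then have "i \<le> n" "2 * i \<le> Suc n"
      by auto
    have "(Suc n - 2 * i) * ((Suc n - i) choose i) = (Suc n - i) * ((n - i) choose i)"
      using binomial_absorb_comp[of "Suc n - i" i] \<open>i \<le> n\<close> by (simp add: mult_2)
    then show "of_nat ((Suc n - 2 * i) * ((Suc n - i) choose i) div (Suc n - i)) * (- a) ^ i
        = of_nat ((n - i) choose i) * (- a) ^ i"
      using \<open>i \<le> n\<close> by simp
  qed
  also have "\<dots> = (\<Sum>i\<le>n. of_nat ((n - i) choose i) * (- a) ^ i)"
    by (rule sum.mono_neutral_cong) (auto simp: binomial_eq_0)
  finally show ?thesis .
qed

lemma fps_rdickson3:
  fixes a :: "'a::comm_ring_1"
  shows "Abs_fps (\<lambda>n. rdickson3 n 1 a) * (1 - fps_X + fps_const a * fps_X ^ 2) = fps_X"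
proof (rule fps_ext)
  fix n
  have 0: "rdickson3 0 1 a = 0" and 1: "rdickson3 (Suc 0) 1 a = 1"
    by (simp_all add: rdickson3_def rdickson3_Suc)
  have rec: "rdickson3 (Suc (Suc m)) 1 a = rdickson3 (Suc m) 1 a - a * rdickson3 m 1 a" for m
    using sum_diagonal_binomial_rec[of "m - 1" "- a"]
    by (cases m) (simp_all add: 0 rdickson3_Suc)
  have *: "f * (1 - fps_X + fps_const a * fps_X ^ 2)
      = f - fps_X * f + fps_const a * (fps_X ^ 2 * f)" for f
    by (simp add: algebra_simps)
  show "(Abs_fps (\<lambda>n. rdickson3 n 1 a) * (1 - fps_X + fps_const a * fps_X ^ 2)) $ n = fps_X $ n"
    unfolding *
    by (cases n; cases "n - 1") (auto simp: 0 1 rec fps_X_power_mult_nth)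
qed

text \<open>With \<open>N = q - 1\<close>, the geometric sum \<open>T a\<close> turns the
  denominator \<open>Y + a X^2\<close> into \<open>Y^N - a^N X^(2N)\<close>. As
  \<open>a^N = 1\<close> unless \<open>a = 0\<close>, this is the same for all other
  \<open>a\<close>, and only a correction at \<open>a = 0\<close> survives the summation.\<close>

lemma fps_sum_rdickson3:
  assumes q: "q = card (UNIV :: 'a::finite_field set)" and "odd q"
  defines "G \<equiv> Abs_fps (\<lambda>n. \<Sum>a\<in>(UNIV :: 'a set). rdickson3 n 1 a)"
  shows "G * ((1 + fps_X ^ (q - 1) - fps_X ^ q) * (1 - fps_X ^ (q - 1))) = - (fps_X ^ (2 * q - 1))"
proof -
  define N where "N = q - 1"
  have qN: "q = Suc N"
    using \<open>odd q\<close> by (auto simp: N_def elim: oddE)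
  have N: "even N"
    using \<open>odd q\<close> qN by simp
  have "N > 0"
    using card_finite_field_gt_1[where 'a = 'a] q by (simp add: N_def)
  define X Y :: "'a fps" where "X = fps_X" and "Y = 1 - X"
  define u where "u = (\<lambda>a::'a. Abs_fps (\<lambda>n. rdickson3 n 1 a))"
  define T where "T = (\<lambda>a. \<Sum>i<N. Y ^ (N - Suc i) * (fps_const (-a) * X ^ 2) ^ i)"
  have u: "u a * (Y + fps_const a * X ^ 2) = X" for a
    using fps_rdickson3[of a] by (simp add: u_def Y_def X_def)
  have T: "(Y + fps_const a * X ^ 2) * T a = Y ^ N - fps_const (a ^ N) * X ^ (2 * N)" for a
  proof -
    have "(Y + fps_const a * X ^ 2) * T a = - ((fps_const (-a) * X ^ 2) ^ N - Y ^ N)"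
      unfolding T_def power_diff_sumr2[of "fps_const (-a) * X ^ 2" N Y]
      by (simp add: algebra_simps flip: fps_const_neg)
    also have "(fps_const (-a) * X ^ 2) ^ N = fps_const (a ^ N) * X ^ (2 * N)"
      using N by (simp add: power_mult_distrib fps_const_power flip: power_mult)
    finally show ?thesis
      by simp
  qed
  have aN: "(1 - fps_const (a ^ N)) * fps_const a = 0" for a :: 'a
    using finite_field_power_card_pred[OF _ q, of a]
    by (cases "a = 0") (simp_all add: N_def)
  \<comment> \<open>The extra factor \<open>Y\<close> clears the denominator of
    \<open>u 0 = X / Y\<close>, which enters through the correction at \<open>a = 0\<close>.\<close>
  have single: "Y * (Y ^ N - X ^ (2 * N)) * u a
      = Y * X * T a - (1 - fps_const (a ^ N)) * X ^ (2 * N) * X" for a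
  proof -
    define b k where "b = fps_const a" and "k = fps_const (a ^ N)"
    define D where "D = Y + b * X ^ 2"
    have "D $ 0 = 1"
      by (simp add: D_def Y_def X_def)
    then have "D \<noteq> 0"
      by auto
    have uD: "u a * D = X" and TD: "D * T a = Y ^ N - k * X ^ (2 * N)" and kb: "(1 - k) * b = 0"
      using u[of a] T[of a] aN[of a] by (simp_all only: D_def b_def k_def)
    have "(Y * (Y ^ N - X ^ (2 * N)) * u a) * D = Y * (Y ^ N - X ^ (2 * N)) * (u a * D)"
      by (simp only: mult_ac)
    also have "\<dots> = Y * X * (D * T a) - (1 - k) * X ^ (2 * N) * X * Y"
      unfolding TD uD by (simp add: algebra_simps)
    \<comment> \<open>The subtracted term is zero; it completes the last \<open>Y\<close> to
      \<open>D\<close>, so that \<open>D\<close> can be cancelled.\<close>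
    also have "\<dots> = Y * X * (D * T a) - (1 - k) * X ^ (2 * N) * X * Y
        - ((1 - k) * b) * X ^ (2 * N) * X ^ 3"
      by (simp add: kb)
    also have "\<dots> = (Y * X * T a - (1 - k) * X ^ (2 * N) * X) * D"
      by (simp add: D_def algebra_simps power2_eq_square power3_eq_cube)
    finally show ?thesis
      using \<open>D \<noteq> 0\<close> by (simp add: k_def)
  qed
  have G: "G = (\<Sum>a\<in>UNIV. u a)"
    by (rule fps_ext) (simp add: G_def u_def fps_sum_nth)
  \<comment> \<open>Only powers \<open>a ^ i\<close> with \<open>i < N\<close> occur in
    \<open>T a\<close>, and their sums over the field vanish.\<close>
  have sumT: "(\<Sum>a\<in>(UNIV::'a set). T a) = 0"
  proof -
    have const: "(\<Sum>a\<in>A. fps_const (f a)) = fps_const (\<Sum>a\<in>A. f a)"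
      for A and f :: "'a \<Rightarrow> 'a"
      by (induction A rule: infinite_finite_induct) simp_all
    have "(\<Sum>a\<in>(UNIV::'a set). T a)
        = (\<Sum>i<N. \<Sum>a\<in>UNIV. Y ^ (N - Suc i) * X ^ (2 * i) * fps_const ((-1) ^ i * a ^ i))"
    proof -
      have "(fps_const (-a) * X ^ 2) ^ i = X ^ (2 * i) * fps_const ((-1) ^ i * a ^ i)"
        for a :: 'a and i
      proof -
        have "(fps_const (-a) * X ^ 2) ^ i = X ^ (2 * i) * fps_const ((- a) ^ i)"
          by (simp add: power_mult_distrib mult.commute flip: power_mult)
        then show ?thesis
          by (simp only: power_minus[of a i])
      qed
      then show ?thesis
        unfolding T_def by (subst sum.swap) (simp only: mult.assoc)
    qed
    also have "\<dots> = (\<Sum>i<N. Y ^ (N - Suc i) * X ^ (2 * i)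
          * fps_const ((-1) ^ i * (\<Sum>a\<in>(UNIV :: 'a set). a ^ i)))"
      by (simp only: const flip: sum_distrib_left)
    also have "\<dots> = 0"
      using sum_powers_finite_field[OF q] by (intro sum.neutral) (auto simp: N_def)
    finally show ?thesis .
  qed
  have "1 - fps_const (a ^ N) = (if a = 0 then 1 else 0)" for a :: 'a
    using finite_field_power_card_pred[OF _ q, of a] \<open>N > 0\<close> by (simp add: N_def)
  then have sum1: "(\<Sum>a\<in>(UNIV::'a set). 1 - fps_const (a ^ N)) = 1"
    by simp
  have "Y * (Y ^ N - X ^ (2 * N)) * G
      = Y * X * (\<Sum>a\<in>UNIV. T a)
        - (\<Sum>a\<in>UNIV. 1 - fps_const (a ^ N)) * X ^ (2 * N) * X"
    by (simp only: G single sum_distrib_left sum_distrib_right) (simp only: sum_subtractf)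
  then have "Y * (Y ^ N - X ^ (2 * N)) * G = - (X ^ (2 * N) * X)"
    by (simp only: sumT sum1) simp
  moreover have "Y * Y ^ N = 1 - X * X ^ N"
  proof -
    have "fps_of_poly ([:-1, 1:] ^ q) = fps_of_poly (monom 1 q - [:1::'a:])"
      using linear_power_card[OF q, of 1] by simp
    then have "(X - 1) ^ q = X ^ q - 1"
      by (simp add: fps_of_poly_power fps_of_poly_diff fps_of_poly_monom fps_of_poly_linear X_def)
    moreover have "Y ^ q = - ((X - 1) ^ q)"
      using \<open>odd q\<close> power_minus_odd[of q "X - 1"] by (simp add: Y_def)
    ultimately show ?thesis
      by (simp add: qN)
  qed
  moreover have "X ^ (2 * N) = X ^ N * X ^ N"
    by (simp add: mult_2 power_add)
  ultimately have "(1 - X * X ^ N - (1 - X) * (X ^ N * X ^ N)) * G = - (X ^ (2 * N) * X)"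
    by (simp add: right_diff_distrib Y_def)
  also have "1 - X * X ^ N - (1 - X) * (X ^ N * X ^ N) = (1 + X ^ N - X * X ^ N) * (1 - X ^ N)"
    by (simp add: algebra_simps)
  finally have "G * ((1 + X ^ N - X * X ^ N) * (1 - X ^ N)) = - (X ^ (2 * N) * X)"
    by (simp only: mult.commute)
  then show ?thesis
    by (simp add: X_def qN mult_2 mult_ac)
qed

section \<open>The polynomials with coefficients b and c\<close>

text \<open>With \<open>v = z^(q - 1)\<close> and \<open>q - 1\<close> even, \<open>(z - z^q)^(q -
  1) = v (v - 1)^(q - 1) = v (1 + v + ... + v^(q - 1))\<close>. Hence \<open>bpoly q\<close> is
  \<open>-z\<close> times a geometric sum in \<open>v\<close>.\<close>

lemma bpoly_mult:
  assumes q: "q = card (UNIV :: 'a::finite_field set)" and "odd q"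
  shows "bpoly q * (1 - monom 1 (q - 1)) = - ([:0, 1:] * (1 - monom (1::'a) (q^2 - 1)))"
proof -
  define N where "N = q - 1"
  have qN: "q = Suc N" and N: "even N"
    using \<open>odd q\<close> by (auto simp: N_def elim: oddE)
  define z v :: "'a poly" where "z = [:0, 1:]" and "v = z ^ N"
  \<comment> \<open>The expansion of \<open>(z - 1)^N\<close> is an identity of polynomials, so
    \<open>v\<close> may be substituted for \<open>z\<close>.\<close>
  have geo: "(v - 1) ^ N = (\<Sum>i<q. v ^ i)"
  proof -
    have pc: "pcompose (p ^ n) v = pcompose p v ^ n" for p n
      by (induction n) (simp_all add: pcompose_mult pcompose_1)
    have "pcompose ([:-1, 1:] ^ N) v = pcompose (\<Sum>i<q. monom (1::'a) i) v"
      using linear_power_card_pred[OF q, of 1] by (simp add: N_def)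
    moreover have "[:-1::'a:] = -1"
      by (simp add: one_pCons)
    ultimately show ?thesis
      by (simp add: pc pcompose_sum monom_altdef pcompose_smult pcompose_pCons algebra_simps)
  qed
  have "(z - z ^ q) ^ N = (- (z * (v - 1))) ^ N"
    by (simp add: qN v_def algebra_simps)
  also have "\<dots> = v * (\<Sum>i<q. v ^ i)"
    using N by (simp add: power_mult_distrib geo flip: v_def)
  finally have "bpoly q = z * (- 1 - v * (\<Sum>i<q. v ^ i))"
    by (simp add: bpoly_def monom_altdef z_def N_def)
  moreover have "v ^ q - 1 = (v - 1) * (\<Sum>i<q. v ^ i)"
    using power_diff_sumr2[of v q 1] by simp
  then have "v ^ q = 1 + v * (\<Sum>i<q. v ^ i) - (\<Sum>i<q. v ^ i)"
    by (simp add: algebra_simps)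
  ultimately have "bpoly q * (1 - v) = - (z * (1 - v * v ^ q))"
    by (simp only:) (simp add: algebra_simps)
  also have "v * v ^ q = z ^ (q^2 - 1)"
    by (simp add: v_def qN power2_eq_square algebra_simps flip: power_mult power_add)
  finally show ?thesis
    by (simp add: monom_altdef z_def v_def N_def)
qed

lemma cpoly_eq:
  assumes q: "q = card (UNIV :: 'a::finite_field set)" and "odd q"
  shows "cpoly q = [:0, 1:] * ([:-2, 1:] ^ (q - 1)) ^ 2 * (\<Sum>m\<le>q. monom (1::'a) (m * (q - 1)))"
proof -
  define N where "N = q - 1"
  have qN: "q = Suc N" and N: "even N"
    using \<open>odd q\<close> by (auto simp: N_def elim: oddE)
  have "N > 0"
    using card_finite_field_gt_1[where 'a = 'a] q by (simp add: N_def)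
  have "(2::'a) \<noteq> 0"
    using two_neq_0_odd_card[where 'a = 'a] assms by simp
  then have four: "(4::'a) \<noteq> 0"
    by (metis mult_2_right mult_eq_0_iff numeral_Bit0 one_add_one)
  define z v y E B where "z = [:0, 1::'a:]" and "v = z ^ N" and "y = [:-1, 1::'a:]"
    and "E = ([:-2, 1::'a:] ^ N) ^ 2" and "B = (bpoly q :: 'a poly)"
  define s where "s = [:1/4:] * z ^ 2"
  define W where "W = z ^ (q^2 - 1)"
  define Sg where "Sg = (\<Sum>k = 1..q^2 - 1. z ^ k)"
  define V where "V = (\<Sum>m\<le>q. v ^ m)"
  define A where "A = (\<Sum>j<q. y ^ (N - j) * s ^ j)"
  have "q^2 = Suc (q^2 - 1)"
    by (simp add: qN power2_eq_square)
  have V: "V * (1 - v) = 1 - W"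
  proof -
    have "V * (1 - v) = 1 - v ^ Suc q"
      using power_diff_sumr2[of v "Suc q" 1] by (simp add: V_def lessThan_Suc_atMost algebra_simps)
    also have "v ^ Suc q = W"
      by (simp add: v_def W_def qN power2_eq_square algebra_simps flip: power_mult power_add)
    finally show ?thesis .
  qed
  have Sg: "Sg * (1 - z) = z * (1 - W)"
  proof -
    have "Sg = (\<Sum>k<q^2 - 1. z ^ Suc k)"
      unfolding Sg_def by (rule sum.reindex_bij_witness[of _ Suc "\<lambda>k. k - 1"]) auto
    then have "Sg * (1 - z) = z * ((\<Sum>k<q^2 - 1. z ^ k) * (1 - z))"
      by (simp add: sum_distrib_left algebra_simps)
    also have "(\<Sum>k<q^2 - 1. z ^ k) * (1 - z) = 1 - W"
      using power_diff_sumr2[of z "q^2 - 1" 1] by (simp add: W_def algebra_simps)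
    finally show ?thesis .
  qed
  have B: "B * (1 - v) = - (z * (1 - W))"
    using bpoly_mult[OF q \<open>odd q\<close>] by (simp add: B_def z_def v_def W_def N_def monom_altdef)
  have yN: "y ^ N * (1 - z) = 1 - z * v"
  proof -
    have "y ^ q = z ^ q - 1"
      using linear_power_card[OF q, of 1] by (simp add: y_def z_def monom_altdef one_pCons)
    moreover have "y ^ N * (1 - z) = - (y ^ q)"
      by (simp add: y_def z_def qN one_pCons flip: mult_minus_left)
    ultimately show ?thesis
      by (simp add: qN v_def)
  qed
  \<comment> \<open>\<open>A\<close> is a geometric sum with quotient
    \<open>(y^q - s^q) / (y - s)\<close>. Here \<open>y - s = -(z - 2)^2 / 4\<close>, and the
    numerator is its \<open>q\<close>-th power, so the quotient is
    \<open>(z - 2)^(2(q - 1))\<close>.\<close>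
  have A: "A = E"
  proof -
    have "(y - s) * A = y ^ q - s ^ q"
      using power_diff_sumr2[of s q y] by (simp add: A_def N_def algebra_simps)
    also have "y ^ q = z ^ q - 1"
      using linear_power_card[OF q, of 1] by (simp add: y_def z_def monom_altdef one_pCons)
    also have "s ^ q = [:1/4:] * (z ^ q) ^ 2"
    proof -
      have "[:1/4::'a:] ^ q = [:1/4:]"
        using finite_field_power_card_eq_same[of "1/4::'a"] q by (simp only: poly_const_pow)
      then show ?thesis
        by (simp only: s_def power_mult_distrib mult.commute[of 2] flip: power_mult)
    qed
    also have "z ^ q - 1 - [:1/4:] * (z ^ q) ^ 2 = [:-1/4:] * (z ^ q - [:2:]) ^ 2"
    proof -
      define h where "h = [:1/4::'a:]"
      have two: "[:2::'a:] = 2" and h: "h * 4 = 1" and mh: "[:-1/4:] = - h"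
        using four by (simp_all add: h_def numeral_poly one_pCons)
      have "- h * (z ^ q - 2) ^ 2 = (h * 4) * (z ^ q - 1) - h * (z ^ q) ^ 2"
        by (simp add: power2_eq_square algebra_simps)
      also have "\<dots> = z ^ q - 1 - h * (z ^ q) ^ 2"
        unfolding h by simp
      finally show ?thesis
        unfolding two mh h_def[symmetric] by simp
    qed
    also have "z ^ q - [:2:] = [:-2, 1:] * [:-2, 1:] ^ N"
      using linear_power_card[OF q, of 2] by (simp add: z_def monom_altdef qN)
    also have "[:-1/4:] * ([:-2, 1:] * [:-2, 1:] ^ N) ^ 2 = ([:-1/4:] * [:-2, 1:] ^ 2) * E"
      by (simp only: E_def power_mult_distrib mult.assoc)
    also have "[:-1/4:] * [:-2, 1:] ^ 2 = y - s"
      using four by (simp add: y_def s_def z_def power2_eq_square)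
    finally have "(y - s) * A = (y - s) * E" .
    moreover have "y - s \<noteq> 0"
      using four by (simp add: y_def s_def z_def power2_eq_square)
    ultimately show ?thesis
      by simp
  qed
  \<comment> \<open>The sum in the definition starts at \<open>j = 1\<close>, so the term
    \<open>y ^ N\<close> of \<open>A\<close> has to be removed.\<close>
  have c: "cpoly q = (1 + v - z * v) * Sg - (v ^ 2 + E - y ^ N) * B"
  proof -
    have "A = y ^ N + (\<Sum>j = 1..N. y ^ (N - j) * s ^ j)"
    proof -
      have "(\<Sum>j = 1..N. y ^ (N - j) * s ^ j) = (\<Sum>j<N. y ^ (N - Suc j) * s ^ Suc j)"
        by (rule sum.reindex_bij_witness[of _ Suc "\<lambda>k. k - 1"]) auto
      then show ?thesis
        unfolding A_def qN by (subst sum.lessThan_Suc_shift) simp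
    qed
    moreover have "s ^ j = monom 1 (2 * j) * [:(1/4) ^ j:]" for j
    proof -
      have "s ^ j = [:(1/4) ^ j:] * z ^ (2 * j)"
        by (simp only: s_def power_mult_distrib poly_const_pow flip: power_mult)
      then show ?thesis
        by (simp add: z_def monom_altdef)
    qed
    moreover have "z ^ (2 * N) = z ^ N * z ^ N"
      by (simp add: mult_2 power_add)
    ultimately show ?thesis
      unfolding A
      by (simp add: cpoly_def v_def B_def Sg_def N_def[symmetric] z_def y_def monom_altdef qN
          power2_eq_square)
  qed
  \<comment> \<open>\<open>P\<close> clears the denominators of both \<open>Sg\<close> and
    \<open>B\<close>.\<close>
  define P where "P = (1 - z) * (1 - v)"
  have "z \<noteq> 1" "v \<noteq> 1"
    using \<open>N > 0\<close> monom_eq_1_iff[of "1::'a" N]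
    by (auto simp: z_def v_def one_pCons monom_altdef)
  then have "P \<noteq> 0"
    by (simp add: P_def)
  have "cpoly q * P = (z * E * V) * P"
  proof -
    have "cpoly q * P = (1 + v - z * v) * (1 - v) * (Sg * (1 - z))
        - ((v ^ 2 + E) * (1 - z) - y ^ N * (1 - z)) * (B * (1 - v))"
      by (simp add: c P_def algebra_simps)
    \<comment> \<open>As \<open>(1 + v - z v)(1 - v) = (1 - z v) - v^2 (1 - z)\<close>, everything
      except the contribution of \<open>E\<close> cancels.\<close>
    also have "\<dots> = z * E * (1 - W) * (1 - z)"
      unfolding Sg B yN by (simp add: algebra_simps power2_eq_square)
    also have "\<dots> = z * E * V * P"
      by (simp add: P_def mult_ac flip: V)
    finally show ?thesis .
  qed
  with \<open>P \<noteq> 0\<close> have "cpoly q = z * E * V"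
    by simp
  also have "V = (\<Sum>m\<le>q. monom 1 (m * N))"
    by (simp add: V_def v_def z_def monom_altdef mult.commute flip: power_mult)
  finally show ?thesis
    by (simp only: z_def E_def N_def)
qed

text \<open>Of the shifted copies of \<open>(z - 2)^(2(q - 1))\<close> only the last two reach index
  \<open>q^2 + i\<close>, and the last but one does so only with its leading coefficient 1, at
  \<open>i = 0\<close>.\<close>

lemma ccoef_top:
  assumes q: "q = card (UNIV :: 'a::finite_field set)" and "odd q" and "i < q"
  shows "ccoef q (q^2 + i) = (if i = 0 then 1 else 0) - of_nat i * (1 / 2 :: 'a) ^ i"
proof -
  define N where "N = q - 1"
  have qN: "q = Suc N"
    using \<open>odd q\<close> by (auto simp: N_def elim: oddE)
  have "N > 0"
    using card_finite_field_gt_1[where 'a = 'a] q by (simp add: N_def)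
  define e where "e = coeff (([:-2, 1::'a:] ^ N) ^ 2)"
  have e: "e (N + i) = (if i \<le> N then - (of_nat i * (1 / 2) ^ i) else 0)" for i
    using coeff_linear_power_square_ge[OF q \<open>odd q\<close>] by (simp add: e_def N_def)
  have "ccoef q (q^2 + i) = (\<Sum>m\<le>q. e (N + (i + (q - m) * N)))"
  proof -
    have "coeff (monom 1 (m * N) * pCons 0 (([:-2, 1:] ^ N) ^ 2)) (q^2 + i)
        = e (N + (i + (q - m) * N))" if "m \<le> q" for m
    proof -
      have "m * N + (q - m) * N = q * N"
        using that by (simp flip: distrib_right)
      moreover have "q^2 = q * N + Suc N"
        by (simp add: qN power2_eq_square)
      ultimately have "q^2 + i = m * N + Suc (N + (i + (q - m) * N))"
        by linarith
      then show ?thesis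
        by (simp add: coeff_monom_mult e_def add_ac)
    qed
    then show ?thesis
      by (simp add: ccoef_def cpoly_eq[OF q \<open>odd q\<close>, folded N_def] sum_distrib_left coeff_sum
          mult.commute[of _ "monom _ _"])
  qed
  also have "\<dots> = (\<Sum>t\<le>q. e (N + (i + t * N)))"
    by (rule sum.reindex_bij_witness[of _ "\<lambda>t. q - t" "\<lambda>t. q - t"]) auto
  also have "\<dots> = (\<Sum>t\<in>{0, 1}. e (N + (i + t * N)))"
  proof (rule sum.mono_neutral_right)
    show "\<forall>t\<in>{..q} - {0, 1}. e (N + (i + t * N)) = 0"
    proof
      fix t
      assume "t \<in> {..q} - {0, 1}"
      then have "2 * N \<le> t * N"
        by (intro mult_right_mono) auto
      then have "\<not> i + t * N \<le> N"
        using \<open>N > 0\<close> by linarith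
      then show "e (N + (i + t * N)) = 0"
        by (simp only: e if_False)
    qed
  qed (use qN in auto)
  also have "\<dots> = e (N + i) + e (N + (i + N))"
    by simp
  also have "e (N + (i + N)) = (if i = 0 then 1 else 0)"
  proof -
    have "of_nat N = (-1::'a)"
      using of_nat_card_pred[OF q] by (simp add: N_def)
    moreover have "(1 / 2 :: 'a) ^ N = 1"
      using half_power_card_pred[OF q \<open>odd q\<close>] by (simp only: N_def)
    ultimately show ?thesis
      by (simp add: e)
  qed
  finally show ?thesis
    using \<open>i < q\<close> qN by (simp add: e)
qed

section \<open>Comparison of coefficients\<close>

lemma fps_nth_eq_0_if_dvd_X_power:
  fixes U F H :: "'a::field fps"
  assumes "U * F = fps_X ^ k * H" and "U $ 0 \<noteq> 0" and "n < k"
  shows "F $ n = 0"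
proof -
  have "F = (inverse U * U) * F"
    using assms(2) by (simp add: inverse_mult_eq_1)
  also have "\<dots> = fps_X ^ k * (inverse U * H)"
    using assms(1) by (simp add: mult_ac)
  finally show ?thesis
    using assms(3) by (simp add: fps_X_power_mult_nth)
qed

lemma sum_rdickson3_recurrence:
  fixes S :: "nat \<Rightarrow> 'a::finite_field"
  assumes q: "q = card (UNIV :: 'a set)" and "odd q" and "n < q^2"
  defines "S \<equiv> (\<lambda>n. \<Sum>a\<in>UNIV. rdickson3 n 1 a)"
  shows "S n + (if n \<ge> q - 1 then S (n - (q - 1)) else 0) - (if n \<ge> q then S (n - q) else 0)
    + ccoef q n = (if n < q then of_nat n else 1) * (1 / 2) ^ (n - 1)"
proof -
  define N where "N = q - 1"
  have qN: "q = Suc N"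
    using \<open>odd q\<close> by (auto simp: N_def elim: oddE)
  have "N > 0"
    using card_finite_field_gt_1[where 'a = 'a] q by (simp add: N_def)
  define h where "h = (1 / 2 :: 'a)"
  have hN: "h ^ N = 1"
    using half_power_card_pred[OF q \<open>odd q\<close>] by (simp add: h_def N_def)
  define X :: "'a fps" where "X = fps_X"
  define G where "G = Abs_fps S"
  define r where "r = (\<lambda>n. (if n < q then of_nat n else 1) * h ^ (n - 1))"
  define R where "R = Abs_fps r"
  define Ep where "Ep = ([:-2, 1::'a:] ^ N) ^ 2"
  define E where "E = fps_of_poly Ep"
  define C where "C = fps_of_poly (cpoly q :: 'a poly)"
  have E_le: "coeff Ep m = of_nat (Suc m) * h ^ m" if "m \<le> N" for m
    using coeff_linear_power_square_le[OF q \<open>odd q\<close>] that by (simp add: Ep_def h_def N_def)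
  have E_ge: "coeff Ep (N + i) = (if i \<le> N then - (of_nat i * h ^ i) else 0)" for i
    using coeff_linear_power_square_ge[OF q \<open>odd q\<close>] by (simp add: Ep_def h_def N_def)
  \<comment> \<open>Since \<open>h ^ N = 1\<close>, the differences
    \<open>r (m + 1) - r (m + 1 - N)\<close> are the coefficients of \<open>E\<close>, except at
    \<open>m = 2 * N\<close>, where the difference is 0 and \<open>E\<close> has coefficient
    1.\<close>
  have r: "R - X ^ N * R = X * (E - X ^ (2 * N))"
  proof (rule fps_ext)
    fix n
    show "(R - X ^ N * R) $ n = (X * (E - X ^ (2 * N))) $ n"
    proof (cases n)
      case 0
      then show ?thesis
        using \<open>N > 0\<close> by (simp add: X_def R_def r_def fps_X_power_mult_nth qN)
    next
      case (Suc m)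
      have R: "(R - X ^ N * R) $ n = r (Suc m) - (if N \<le> Suc m then r (Suc m - N) else 0)"
        using Suc by (simp add: X_def R_def fps_X_power_mult_nth)
      have E: "(X * (E - X ^ (2 * N))) $ n = coeff Ep m - (if m = 2 * N then 1 else 0)"
        using Suc by (simp add: X_def E_def)
      show ?thesis
      proof (cases "m < N")
        case True
        then show ?thesis
          unfolding R E by (auto simp: r_def E_le qN)
      next
        case False
        define i where "i = m - N"
        have m: "m = N + i" "Suc m - N = Suc i"
          using False by (simp_all add: i_def)
        have "of_nat N = (-1::'a)"
          using of_nat_card_pred[OF q] by (simp add: N_def)
        then show ?thesis
          unfolding R E m(2) by (auto simp: m(1) r_def E_ge qN power_add hN algebra_simps)
      qed
    qed
  qed
  have c: "C * (1 - X ^ N) = (X - X ^ (q^2)) * E"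
  proof -
    define V where "V = (\<Sum>m\<le>q. (X ^ N) ^ m)"
    have "V * (1 - X ^ N) = 1 - (X ^ N) ^ Suc q"
      using power_diff_sumr2[of "X ^ N" "Suc q" 1]
      by (simp add: V_def lessThan_Suc_atMost algebra_simps)
    then have "X * (V * (1 - X ^ N)) = X - X * (X ^ N) ^ Suc q"
      by (simp only: right_diff_distrib mult_1_right)
    also have "X * (X ^ N) ^ Suc q = X ^ Suc (N * Suc q)"
      by (simp only: power_Suc[of X] power_mult)
    also have "Suc (N * Suc q) = q^2"
      by (simp add: qN power2_eq_square)
    finally have "X * (V * (1 - X ^ N)) = X - X ^ (q^2)" .
    moreover have "V = fps_of_poly (\<Sum>m\<le>q. monom 1 (m * N))"
      by (simp add: V_def X_def fps_of_poly_sum fps_of_poly_monom' mult.commute flip: power_mult)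
    then have "C = X * E * V"
      unfolding C_def cpoly_eq[OF q \<open>odd q\<close>]
      by (simp only: fps_of_poly_mult fps_of_poly_fps_X X_def E_def Ep_def N_def)
    ultimately show ?thesis
      by (simp add: mult_ac)
  qed
  have g: "G * (1 + X ^ N - X ^ q) * (1 - X ^ N) = - (X * X ^ (2 * N))"
    using fps_sum_rdickson3[OF q \<open>odd q\<close>]
    by (simp add: G_def S_def X_def N_def[symmetric] mult.assoc) (simp add: qN)
  \<comment> \<open>Adding the three identities cancels \<open>X * E\<close> and
    \<open>X * X ^ (2 * N)\<close>; only a multiple of \<open>X ^ (q^2)\<close> remains.\<close>
  have "(1 - X ^ N) * (G * (1 + X ^ N - X ^ q) + C - R)
      = G * (1 + X ^ N - X ^ q) * (1 - X ^ N) + C * (1 - X ^ N) - (R - X ^ N * R)"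
    by (simp add: algebra_simps)
  also have "\<dots> = X ^ (q^2) * - E"
    unfolding r c g by (simp add: algebra_simps)
  finally have "(G * (1 + X ^ N - X ^ q) + C - R) $ n = 0"
    unfolding X_def
    by (rule fps_nth_eq_0_if_dvd_X_power) (use \<open>N > 0\<close> \<open>n < q^2\<close> in simp_all)
  moreover have "G * (1 + X ^ N - X ^ q) = G + X ^ N * G - X ^ q * G"
    by (simp add: algebra_simps)
  ultimately have "(G + X ^ N * G - X ^ q * G) $ n + ccoef q n = r n"
    by (simp add: C_def R_def ccoef_def)
  then show ?thesis
    by (auto simp: G_def X_def fps_X_power_mult_nth r_def N_def h_def)
qed

text \<open>The sum truncates \<open>1 / ((1 - v)(1 - v y))\<close>, in which \<open>v^m\<close> has
  coefficient \<open>1 + y + ... + y^m\<close>; the error is a multiple of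
  \<open>v ^ M\<close>.\<close>

lemma geometric_convolution:
  fixes v y :: "'a::comm_ring_1"
  shows "(1 - v) * (1 - v * y) * (\<Sum>m<M. v ^ m * (\<Sum>r\<le>m. y ^ r))
    = 1 - v ^ M * ((\<Sum>r\<le>M. y ^ r) - v * y * (\<Sum>r<M. y ^ r))"
proof (induction M)
  case (Suc M)
  define H K where "H = (\<Sum>r\<le>M. y ^ r)" and "K = (\<Sum>r<M. y ^ r)"
  have H: "H = K + y ^ M"
    by (simp add: H_def K_def flip: lessThan_Suc_atMost)
  define T where "T = (\<Sum>m<M. v ^ m * (\<Sum>r\<le>m. y ^ r))"
  have "(1 - v) * (1 - v * y) * T = 1 - v ^ M * (H - v * y * K)"
    using Suc.IH by (simp only: T_def H_def K_def)
  then have "(1 - v) * (1 - v * y) * (T + v ^ M * H)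
      = 1 - v ^ M * (H - v * y * K) + (1 - v) * (1 - v * y) * (v ^ M * H)"
    by (simp only: distrib_left)
  also have "\<dots> = 1 - v ^ Suc M * (H + y ^ Suc M - v * y * H)"
    by (simp add: H algebra_simps)
  finally show ?case
    by (simp add: T_def H_def flip: lessThan_Suc_atMost)
qed simp

text \<open>Below \<open>z^(q^2)\<close> the series \<open>G\<close> is \<open>-z^(2N + 1) L\<close>
  with \<open>N = q - 1\<close>. The blocks \<open>z^(m N) H m\<close> of \<open>L\<close> do not
  overlap, as \<open>H m\<close> has degree at most \<open>m < N\<close>, so a coefficient of
  \<open>L\<close> is read off from one block or from a gap.\<close>

lemma sum_rdickson3_top:
  assumes q: "q = card (UNIV :: 'a::finite_field set)" and "odd q" and "j < q"
  shows "(\<Sum>a\<in>(UNIV :: 'a set). rdickson3 (q^2 - q + j) 1 a)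
    = (if j = 0 then 0 else 1 - (1 / 2) ^ (j - 1))"
proof -
  define N where "N = q - 1"
  have qN: "q = Suc N" and "even N"
    using \<open>odd q\<close> by (auto simp: N_def elim: oddE)
  moreover have "N > 0"
    using card_finite_field_gt_1[where 'a = 'a] q by (simp add: N_def)
  \<comment> \<open>\<open>N\<close> is even and positive, hence at least 2. The last block of
    \<open>L\<close> is then \<open>Suc M\<close>.\<close>
  ultimately obtain M where M: "N = Suc (Suc M)"
    by (metis One_nat_def odd_one not0_implies_Suc less_numeral_extra(3))
  define X :: "'a fps" where "X = fps_X"
  define G where "G = Abs_fps (\<lambda>n. \<Sum>a\<in>(UNIV :: 'a set). rdickson3 n 1 a)"
  define H where "H = (\<lambda>m. \<Sum>r\<le>m. [:-1, 1::'a:] ^ r)"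
  define L where "L = (\<Sum>m<N. monom 1 (m * N) * H m)"
  define D where "D = (\<Sum>r\<le>N. (X - 1) ^ r) - X ^ N * (X - 1) * (\<Sum>r<N. (X - 1) ^ r)"
  define U where "U = (1 - X ^ N) * (1 - X ^ N * (X - 1))"
  have UL: "U * fps_of_poly L = 1 - X ^ (N * N) * D"
  proof -
    have y: "fps_of_poly [:-1, 1::'a:] = fps_X - 1"
      by (simp add: fps_of_poly_linear flip: fps_const_neg)
    have "fps_of_poly L = (\<Sum>m<N. (X ^ N) ^ m * (\<Sum>r\<le>m. (X - 1) ^ r))"
      by (simp add: L_def H_def X_def fps_of_poly_sum fps_of_poly_mult fps_of_poly_power
          fps_of_poly_monom' y mult.commute[of _ N] power_mult)
    then show ?thesis
      using geometric_convolution[of "X ^ N" "X - 1" N] by (simp add: D_def U_def power_mult)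
  qed
  have UG: "U * G = - (X ^ (2 * N + 1))"
    using fps_sum_rdickson3[OF q \<open>odd q\<close>]
    by (simp add: G_def X_def N_def[symmetric] U_def) (simp add: qN algebra_simps)
  have "U * (G + X ^ (2 * N + 1) * fps_of_poly L) = U * G + X ^ (2 * N + 1) * (U * fps_of_poly L)"
    by (simp only: distrib_left mult.left_commute)
  also have "\<dots> = - (X ^ (2 * N + 1) * X ^ (N * N) * D)"
    unfolding UG UL by (simp only: right_diff_distrib) simp
  also have "X ^ (2 * N + 1) * X ^ (N * N) = X ^ (2 * N + 1 + N * N)"
    by (simp only: power_add)
  also have "2 * N + 1 + N * N = q^2"
    by (simp add: qN power2_eq_square)
  finally have *: "U * (G + X ^ (2 * N + 1) * fps_of_poly L) = X ^ (q^2) * - D"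
    by simp
  have "(G + X ^ (2 * N + 1) * fps_of_poly L) $ (q^2 - q + j) = 0"
  proof (rule fps_nth_eq_0_if_dvd_X_power)
    show "U * (G + X ^ (2 * N + 1) * fps_of_poly L) = fps_X ^ (q^2) * - D"
      using * by (simp add: X_def)
    show "U $ 0 \<noteq> 0"
      using \<open>N > 0\<close> by (simp add: U_def X_def)
    show "q^2 - q + j < q^2"
      using \<open>j < q\<close> by (simp add: power2_eq_square qN)
  qed
  moreover have "2 * N + 1 \<le> q^2 - q + j"
    by (simp add: qN M power2_eq_square)
  ultimately have S: "(\<Sum>a\<in>(UNIV :: 'a set). rdickson3 (q^2 - q + j) 1 a)
      = - coeff L (q^2 - q + j - (2 * N + 1))"
    by (simp add: G_def X_def fps_X_power_mult_nth eq_neg_iff_add_eq_0 del: power_Suc)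
  have L: "coeff L k = (\<Sum>m<N. if k < m * N then 0 else coeff (H m) (k - m * N))" for k
    unfolding L_def coeff_sum coeff_monom_mult by (intro sum.cong) simp_all
  have H0: "coeff (H m) i = 0" if "m < i" for m i
    unfolding H_def coeff_sum using that
    by (intro sum.neutral ballI coeff_eq_0) (simp add: degree_linear_power)
  show ?thesis
  proof (cases j)
    case 0
    \<comment> \<open>This index lies in the gap between the end of block \<open>M\<close>, whose
      degree is at most \<open>M\<close>, and the start of the last block.\<close>
    have "q^2 - q + j - (2 * N + 1) = M * N + Suc M"
      using 0 by (simp add: qN M power2_eq_square)
    moreover have "coeff L (M * N + Suc M) = 0"
      unfolding L
    proof (rule sum.neutral, rule ballI)
      fix m
      assume "m \<in> {..<N}"
      show "(if M * N + Suc M < m * N then 0 else coeff (H m) (M * N + Suc M - m * N)) = 0"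
      proof (cases "m \<le> M")
        case True
        then have "m * N \<le> M * N"
          by (rule mult_right_mono) simp
        then have "m < M * N + Suc M - m * N"
          using True by linarith
        then show ?thesis
          by (simp add: H0)
      next
        case False
        then have "Suc M * N \<le> m * N"
          by (intro mult_right_mono) auto
        then have "M * N + Suc M < m * N"
          using M by simp
        then show ?thesis
          by simp
      qed
    qed
    ultimately show ?thesis
      using 0 S by simp
  next
    case (Suc t)
    have "q^2 - q + j - (2 * N + 1) = Suc M * N + t"
      using Suc by (simp add: qN M power2_eq_square)
    moreover have "coeff L (Suc M * N + t) = coeff (H (Suc M)) t"
    proof -
      have "coeff L (Suc M * N + t) = (\<Sum>m\<in>{Suc M}. coeff (H m) (Suc M * N + t - m * N))"
        unfolding L
      proof (rule sum.mono_neutral_cong_right)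
        show "\<forall>m\<in>{..<N} - {Suc M}. (if Suc M * N + t < m * N then 0
            else coeff (H m) (Suc M * N + t - m * N)) = 0"
        proof
          fix m
          assume "m \<in> {..<N} - {Suc M}"
          then have "m \<le> M"
            using M by auto
          then have "m * N \<le> M * N"
            by (rule mult_right_mono) simp
          then have "m < Suc M * N + t - m * N"
            using \<open>m \<le> M\<close> M by simp
          then show "(if Suc M * N + t < m * N then 0
              else coeff (H m) (Suc M * N + t - m * N)) = 0"
            by (simp add: H0)
        qed
      qed (auto simp: M)
      then show ?thesis
        by simp
    qed
    \<comment> \<open>Adding the missing power \<open>y ^ N\<close> completes the sum to
      \<open>(y^q - 1) / (y - 1) = (z - 2)^q / (z - 2)\<close>.\<close>
    moreover have "H (Suc M) = [:-2, 1:] ^ N - [:-1, 1:] ^ N"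
    proof -
      define y where "y = [:-1, 1::'a:]"
      have "y - 1 = [:-2, 1:]"
        by (simp add: y_def one_pCons)
      have "[:-2, 1:] * (\<Sum>r<q. y ^ r) = y ^ q - 1"
        using power_diff_sumr2[of y q 1] \<open>y - 1 = _\<close> by simp
      also have "\<dots> = [:-2, 1:] * [:-2, 1:] ^ N"
        using linear_power_card[OF q, of 1] linear_power_card[OF q, of 2]
        by (simp add: y_def one_pCons numeral_poly qN flip: power_Suc)
      finally have "(\<Sum>r<q. y ^ r) = [:-2, 1:] ^ N"
        by (simp only: mult_cancel_left pCons_eq_0_iff one_neq_zero simp_thms)
      moreover have "(\<Sum>r<q. y ^ r) = H (Suc M) + y ^ N"
      proof -
        have "{..Suc M} = {..<N}"
          by (simp only: M lessThan_Suc_atMost)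
        then show ?thesis
          by (simp only: H_def y_def qN sum.lessThan_Suc)
      qed
      ultimately show ?thesis
        by (metis y_def add_diff_cancel_right')
    qed
    moreover have "coeff ([:-2, 1:] ^ N) t = (1 / 2 :: 'a) ^ t"
      using coeff_linear_power_two[OF q \<open>odd q\<close>, of t] Suc \<open>j < q\<close> by (simp add: N_def)
    moreover have "coeff ([:-1, 1:] ^ N) t = (1 :: 'a)"
      using coeff_linear_power_card_pred[OF q, of 1 t] Suc \<open>j < q\<close> by (simp add: N_def)
    ultimately show ?thesis
      using S Suc by simp
  qed
qed

text \<open>The sum telescopes through \<open>f\<close>; at the upper end
  \<open>of_nat q = 0\<close> and \<open>h ^ N = 1\<close> leave the constant -1.\<close>

lemma sum_arith_geometric_half:
  assumes q: "q = card (UNIV :: 'a::finite_field set)" and "odd q" and "j < q"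
  shows "(\<Sum>i = j..q - 1. of_nat i * (1 / 2 :: 'a) ^ i) = 2 * of_nat (Suc j) * (1 / 2) ^ j - 1"
proof -
  define N where "N = q - 1"
  define h where "h = (1 / 2 :: 'a)"
  define f where "f = (\<lambda>i. - (2 * of_nat (Suc i) * h ^ i))"
  have qN: "q = Suc N"
    using \<open>odd q\<close> by (auto simp: N_def elim: oddE)
  have h: "2 * h = 1"
    using two_neq_0_odd_card[where 'a = 'a] assms by (simp add: h_def)
  have "f (Suc i) - f i = of_nat i * h ^ i" for i
  proof -
    have "f (Suc i) - f i = 2 * of_nat (Suc i) * h ^ i - (2 * h) * of_nat (Suc (Suc i)) * h ^ i"
      by (simp add: f_def mult_ac)
    then show ?thesis
      unfolding h by (simp add: algebra_simps)
  qed
  then have "(\<Sum>i = j..N. of_nat i * h ^ i) = f (Suc N) - f j"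
    using sum_Suc_diff[of j N f] \<open>j < q\<close> qN by simp
  also have "f (Suc N) = - ((2 * h) * h ^ N * (of_nat q + 1))"
    by (simp add: f_def qN algebra_simps)
  also have "\<dots> = - 1"
    using half_power_card_pred[OF q \<open>odd q\<close>] of_nat_card_eq_0[where 'a = 'a] q
    unfolding h by (simp add: h_def N_def)
  finally show ?thesis
    by (simp add: f_def h_def N_def)
qed

theorem theorem4p2:
  fixes p q :: nat
  assumes "prime p" and "odd p" and "CHAR('a) = p" and "q = card (UNIV :: 'a set)"
  defines "S \<equiv> (\<lambda>n. \<Sum>a\<in>(UNIV :: 'a::finite_field set). rdickson3 n 1 a)"
      and "c \<equiv> (\<lambda>k. (ccoef q k :: 'a))"
  shows
    "(\<forall>j. 1 \<le> j \<and> j \<le> q - 1 \<longrightarrow> S j = - c j + of_nat j / 2 ^ (j - 1))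
     \<and> S q = c 1 - c q
     \<and> (\<forall>l j. 1 \<le> l \<and> l \<le> q - 2 \<and> 1 \<le> j \<and> j \<le> q - 1 \<longrightarrow>
          S (l*q + j) = S ((l - 1)*q + j) - S ((l - 1)*q + j + 1) - c (l*q + j)
            + (2 ^ q * (1 - of_nat j) + 2 * of_nat j) / 2 ^ (l*q + j))
     \<and> (\<forall>l. 2 \<le> l \<and> l \<le> q - 2 \<longrightarrow>
          S (l*q) = S ((l - 1)*q) - S ((l - 1)*q + 1) - c (l*q) + 1 / 2 ^ ((l - 1)*q))
     \<and> (\<forall>j. j \<le> q - 1 \<longrightarrow>
          S (q^2 - q + j) = (\<Sum>i = j..q - 1. c (q^2 + i)) + of_nat j / 2 ^ (q^2 - q + j - 1))"
proof -
  note q = assms(4)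
  have two: "(2::'a) \<noteq> 0"
  proof
    assume "(2::'a) = 0"
    then have "of_nat 2 = (0::'a)"
      by simp
    then have "CHAR('a) dvd 2"
      by (simp only: of_nat_eq_0_iff_char_dvd)
    with assms(1-3) show False
      by (metis dvd_antisym dvd_refl even_numeral prime_nat_iff primes_dvd_imp_eq two_is_prime_nat)
  qed
  \<comment> \<open>If \<open>q\<close> were even, \<open>(-1)^(q - 1) = 1\<close> would give
    \<open>-1 = 1\<close>, that is, characteristic 2.\<close>
  have "odd q"
  proof
    assume "even q"
    then have "odd (q - 1)"
      using card_finite_field_gt_1[where 'a = 'a] q by simp
    moreover have "(-1::'a) ^ (q - 1) = 1"
      using finite_field_power_card_pred[OF _ q, of "-1"] by simp
    ultimately have "(-1::'a) = 1"
      by simp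
    then have "(1::'a) + 1 = 0"
      by (metis add.right_inverse)
    with two show False
      by simp
  qed
  define h where "h = (1 / 2 :: 'a)"
  have hN: "h ^ (q - 1) = 1"
    using half_power_card_pred[OF q \<open>odd q\<close>] by (simp only: h_def)
  have h2: "2 * h = 1"
    using two by (simp add: h_def)
  have div: "x / 2 ^ n = x * h ^ n" for x n
    by (simp add: h_def power_divide)
  have pow2: "2 ^ q = (2::'a)"
    using finite_field_power_card_eq_same[of "2::'a"] q by simp
  have "q > 1"
    using card_finite_field_gt_1[where 'a = 'a] q by simp
  have rec: "S n + (if n \<ge> q - 1 then S (n - (q - 1)) else 0) - (if n \<ge> q then S (n - q) else 0)
      + c n = (if n < q then of_nat n else 1) * h ^ (n - 1)" if "n < q^2" for n
    using sum_rdickson3_recurrence[OF q \<open>odd q\<close> that] by (simp only: S_def c_def h_def)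
  have S0: "S 0 = 0"
    by (simp add: S_def rdickson3_def)
  have "q < q^2"
    using \<open>q > 1\<close> by (simp add: power2_eq_square)
  have bound: "l * q + j < q^2" if "l \<le> q - 2" "j \<le> q - 1" for l j
  proof -
    have "l * q + j < Suc l * q"
      using that \<open>q > 1\<close> by simp
    also have "\<dots> \<le> q * q"
      using that \<open>q > 1\<close> by (intro mult_right_mono) auto
    finally show ?thesis
      by (simp only: power2_eq_square)
  qed
  have i: "S j = - c j + of_nat j / 2 ^ (j - 1)" if "1 \<le> j" "j \<le> q - 1" for j
  proof -
    \<comment> \<open>At the boundary \<open>j = q - 1\<close> the extra term is
      \<open>S 0 = 0\<close>.\<close>
    have "(if j \<ge> q - 1 then S (j - (q - 1)) else 0) = 0"
      using that S0 by simp
    moreover have "j < q" "j < q^2"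
      using that \<open>q > 1\<close> \<open>q < q^2\<close> by linarith+
    ultimately have "S j + c j = of_nat j * h ^ (j - 1)"
      using rec[of j] by simp
    then show ?thesis
      unfolding div by (simp add: eq_diff_eq flip: minus_add_distrib)
  qed
  have ii: "S q = c 1 - c q"
  proof -
    have "q - (q - 1) = 1"
      using \<open>q > 1\<close> by simp
    then have "S q + S 1 + c q = 1"
      using rec[of q] \<open>q < q^2\<close> S0 hN by simp
    moreover have S1: "S 1 = 1 - c 1"
      using i[of 1] \<open>q > 1\<close> by simp
    ultimately have "S q + c q - c 1 + 1 = 0 + 1"
      unfolding S1 by (simp only: algebra_simps add_0)
    then have "S q + c q - c 1 = 0"
      by (simp only: add_right_cancel)
    then show ?thesis
      by (simp add: eq_diff_eq)
  qed
  \<comment> \<open>Common form of (iii) and (iv), the latter being the case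
    \<open>j = 0\<close>.\<close>
  have block: "S (l * q + j) = S ((l - 1) * q + j) - S ((l - 1) * q + j + 1) - c (l * q + j)
      + h ^ (l * q + j - 1)" if "1 \<le> l" "l \<le> q - 2" "j \<le> q - 1" for l j
  proof -
    have "l * q = (l - 1) * q + q"
      using that(1) by (cases l) simp_all
    then have n: "q - 1 \<le> l * q + j" "q \<le> l * q + j" "\<not> l * q + j < q"
      "l * q + j - q = (l - 1) * q + j"
      "l * q + j - (q - 1) = (l - 1) * q + j + 1"
      using \<open>q > 1\<close> by simp_all
    have "S (l * q + j) + S ((l - 1) * q + j + 1) - S ((l - 1) * q + j) + c (l * q + j)
        = h ^ (l * q + j - 1)"
      using rec[OF bound[OF that(2,3)]] by (simp only: n if_True if_False mult_1_left)
    then show ?thesis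
      by (simp add: algebra_simps)
  qed
  have iii: "S (l * q + j) = S ((l - 1) * q + j) - S ((l - 1) * q + j + 1) - c (l * q + j)
      + (2 ^ q * (1 - of_nat j) + 2 * of_nat j) / 2 ^ (l * q + j)"
    if "1 \<le> l" "l \<le> q - 2" "1 \<le> j" "j \<le> q - 1" for l j
  proof -
    \<comment> \<open>Since \<open>2 ^ q = 2\<close> in the field, the numerator is just 2.\<close>
    have "(2 ^ q * (1 - of_nat j) + 2 * of_nat j) / 2 ^ (l * q + j) = 2 * h ^ (l * q + j)"
      unfolding div pow2 by (simp add: algebra_simps)
    also have "\<dots> = 2 * h * h ^ (l * q + j - 1)"
      using that by (simp flip: power_Suc)
    finally show ?thesis
      using block[OF that(1,2,4)] by (simp add: h2)
  qed
  have iv: "S (l * q) = S ((l - 1) * q) - S ((l - 1) * q + 1) - c (l * q) + 1 / 2 ^ ((l - 1) * q)"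
    if "2 \<le> l" "l \<le> q - 2" for l
  proof -
    have "l * q = (l - 1) * q + q"
      using that(1) by (cases l) simp_all
    then have "l * q - 1 = (l - 1) * q + (q - 1)"
      using \<open>q > 1\<close> by simp
    then have "h ^ (l * q - 1) = 1 / 2 ^ ((l - 1) * q)"
      by (simp only: power_add hN div mult_1_left mult_1_right)
    then show ?thesis
      using block[of l 0] that by simp
  qed
  have v: "S (q^2 - q + j) = (\<Sum>i = j..q - 1. c (q^2 + i)) + of_nat j / 2 ^ (q^2 - q + j - 1)"
    if "j \<le> q - 1" for j
  proof -
    have "j < q"
      using that \<open>q > 1\<close> by simp
    have "(\<Sum>i = j..q - 1. c (q^2 + i))
        = (\<Sum>i = j..q - 1. (if i = 0 then 1 else 0) - of_nat i * h ^ i)"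
    proof (rule sum.cong[OF refl])
      fix i
      assume "i \<in> {j..q - 1}"
      then have "i < q"
        using \<open>q > 1\<close> by auto
      then show "c (q^2 + i) = (if i = 0 then 1 else 0) - of_nat i * h ^ i"
        unfolding c_def h_def by (rule ccoef_top[OF q \<open>odd q\<close>])
    qed
    also have "\<dots> = (if j = 0 then 1 else 0) + 1 - 2 * of_nat (Suc j) * h ^ j"
      using sum_arith_geometric_half[OF q \<open>odd q\<close> \<open>j < q\<close>]
      by (simp add: sum_subtractf h_def)
    finally have C: "(\<Sum>i = j..q - 1. c (q^2 + i))
        = (if j = 0 then 1 else 0) + 1 - 2 * of_nat (Suc j) * h ^ j" .
    have S: "S (q^2 - q + j) = (if j = 0 then 0 else 1 - h ^ (j - 1))"
      using sum_rdickson3_top[OF q \<open>odd q\<close> \<open>j < q\<close>] by (simp only: S_def h_def)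
    show ?thesis
    proof (cases j)
      case 0
      then show ?thesis
        using S C by simp
    next
      case (Suc t)
      \<comment> \<open>This splits off a multiple of \<open>q - 1\<close>, which does not affect
        powers of \<open>h\<close>.\<close>
      have "q^2 - q + j - 1 = (q - 1) * q + t"
        using Suc by (simp add: power2_eq_square diff_mult_distrib)
      then have "h ^ (q^2 - q + j - 1) = h ^ t"
        by (simp only: power_add power_mult hN power_one mult_1_left)
      then have e1: "of_nat j / 2 ^ (q^2 - q + j - 1) = of_nat j * h ^ t"
        by (simp only: div)
      have "2 * of_nat (Suc j) * h ^ j = (2 * h) * of_nat (Suc j) * h ^ t"
        using Suc by (simp add: mult_ac)
      then have e2: "2 * of_nat (Suc j) * h ^ j = of_nat (Suc j) * h ^ t"
        by (simp only: h2 mult_1_left)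
      show ?thesis
        unfolding S C e1 e2 using Suc by (simp add: algebra_simps)
    qed
  qed
  show ?thesis
    using i ii iii iv v by blast
qed

end
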